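(* Let $n\ge1$, let $R=\mathbb Q[x_1,\dots,x_n]$, let $\mathcal{PF}_n^{B}$ be the Frobenius characteristic of the parking function module of type B, taken in the variables $x_1,\dots,x_n$, and let $\bar\vartheta$ be the polynomial umbra with $f(\bar\vartheta,t)=\prod_{i=1}^n(1-x_it)^{-1}$. Then $$n!\,\mathcal{PF}_n^{B}\;\simeq\;B_n(-1\boldsymbol{.}\bar\vartheta,-1\boldsymbol{.}\bar\vartheta)\;\simeq\;(n\boldsymbol{.}\bar\vartheta)^n,$$ where $B_n(x,\gamma)=(x-(n+1)\boldsymbol{.}\gamma)^n$ is the type B Abel polynomial.
   Context: **Parking functions of type B.** These are the sequences in $[n]^n$, $[n]=\{1,\dots,n\}$. The parking function module of type B is the $\mathbb Q$-vector space with basis $[n]^n$, with $\mathfrak S_n$ acting by permuting the entries of sequences; $\mathcal{PF}_n^{B}$ is the symmetric function associated with its character by the Frobenius map. All symmetric functions are taken in the variables $x_1,\dots,x_n$. **Umbral calculus (over $R=\mathbb Q[x_1,\dots,x_n]$).** One has an alphabet $A$ of symbols (umbrae; polynomial umbrae for this $R$) and an $R$-linear functional $E:R[A]\to R$ with $E[1]=1$ and $E[\alpha^i\gamma^j\cdots\delta^k]=E[\alpha^i]E[\gamma^j]\cdots E[\delta^k]$ for pairwise distinct umbrae (distinct umbrae are "uncorrelated"). For polynomials $p,q$ in umbrae, $p\simeq q$ means $E[p]=E[q]$, and $p\equiv q$ (similarity) means $E[p^i]=E[q^i]$ for all $i\ge0$. The generating function is $f(\alpha,t)=\sum_{i\ge0}E[\alpha^i]\,t^i/i!$.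 The alphabet is enlarged by auxiliary umbrae, to which $E$ is extended with the same uncorrelation property, and as many uncorrelated copies of any umbra as needed are available. For an integer $m$, $m\boldsymbol{.}\alpha$ is an auxiliary umbra with $f(m\boldsymbol{.}\alpha,t)=f(\alpha,t)^m$ (for $m\ge1$ it is similar to a sum of $m$ uncorrelated umbrae similar to $\alpha$). **Type B Abel polynomial.** With Abel polynomials $A_n(x,\gamma)=x(x-n\boldsymbol{.}\gamma)^{n-1}$, one sets $B_n(x,\gamma)=A_{n+1}(x,\gamma)/x=(x-(n+1)\boldsymbol{.}\gamma)^n$. Here $x-m\boldsymbol{.}\gamma$ means $x+(-m)\boldsymbol{.}\gamma$, with $f((-m)\boldsymbol{.}\gamma,t)=f(\gamma,t)^{-m}$; in $B_n(-1\boldsymbol{.}\bar\vartheta,-1\boldsymbol{.}\bar\vartheta)$ the umbra substituted for $x$ and the auxiliary umbra $(-(n+1))\boldsymbol{.}(-1\boldsymbol{.}\bar\vartheta)\equiv(n+1)\boldsymbol{.}\bar\vartheta$ are uncorrelated. **The umbra $\bar\vartheta$.** Let $\chi$ be the singleton umbra, $f(\chi,t)=1+t$. Let $\bar\epsilon\equiv\chi_1x_1+\cdots+\chi_nx_n$ with $\chi_1,\dots,\chi_n$ uncorrelated umbrae similar to $\chi$. Then $\bar\vartheta\equiv-1\boldsymbol{.}(-\bar\epsilon)$; thus $f(\bar\vartheta,t)=\prod_{i=1}^n(1-x_it)^{-1}=\sum_{i\ge0}h_it^i$, i.e. $E[\bar\vartheta^i]=i!\,h_i$. *)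

theory Defs
  imports
    "HOL-Library.Poly_Mapping"
    "HOL-Library.FuncSet"
    "HOL-Library.Cardinality"
    "HOL-Combinatorics.Combinatorics"
    "HOL-Computational_Algebra.Formal_Power_Series"
begin

unbundle fps_syntax

section \<open>Polynomials\<close>

text \<open>
  Polynomials with coefficients in \<open>'r\<close> and indeterminates indexed by \<open>'v\<close>, as finitely supported
  functions on monomials. The ring \<open>R = \<rat>[x\<^sub>1, \<dots>, x\<^sub>n]\<close> is \<open>('n, rat) mpoly\<close> for a finite
  type \<open>'n\<close> with \<open>n = CARD('n)\<close> elements, and \<open>R[A]\<close> is \<open>('a, ('n, rat) mpoly) mpoly\<close>.
\<close>

type_synonym ('v, 'r) mpoly = "('v \<Rightarrow>\<^sub>0 nat) \<Rightarrow>\<^sub>0 'r"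

definition Const :: "'r::zero \<Rightarrow> ('v, 'r) mpoly" where
  "Const r = Poly_Mapping.single 0 r"

definition Var :: "'v \<Rightarrow> ('v, 'r::zero_neq_one) mpoly" where
  "Var v = Poly_Mapping.single (Poly_Mapping.single v 1) 1"


section \<open>The parking function module of type B\<close>

text \<open>Sequences \<open>a \<in> [n]\<^sup>n\<close> are extensional functions on \<open>{1..n}\<close>.\<close>

definition parking_functions_B :: "nat \<Rightarrow> (nat \<Rightarrow> nat) set" where
  "parking_functions_B n = {1..n} \<rightarrow>\<^sub>E {1..n}"

text \<open>The left action \<open>(\<sigma> \<cdot> a)\<^sub>i = a\<^bsub>\<sigma>\<^sup>-\<^sup>1(i)\<^esub>\<close>, extended linearly to the vector space spanned by
  sequences.\<close>

definition permute_entries ::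
  "(nat \<Rightarrow> nat) \<Rightarrow> ((nat \<Rightarrow> nat) \<Rightarrow>\<^sub>0 rat) \<Rightarrow> ((nat \<Rightarrow> nat) \<Rightarrow>\<^sub>0 rat)" where
  "permute_entries \<sigma> v =
     (\<Sum>a\<in>Poly_Mapping.keys v. Poly_Mapping.single (a \<circ> inv \<sigma>) (Poly_Mapping.lookup v a))"

text \<open>Trace of a linear endomorphism of the space with finite basis \<open>B\<close>.\<close>

definition trace_on :: "'b set \<Rightarrow> (('b \<Rightarrow>\<^sub>0 rat) \<Rightarrow> ('b \<Rightarrow>\<^sub>0 rat)) \<Rightarrow> rat" where
  "trace_on B T = (\<Sum>b\<in>B. Poly_Mapping.lookup (T (Poly_Mapping.single b 1)) b)"

definition parking_character_B :: "nat \<Rightarrow> (nat \<Rightarrow> nat) \<Rightarrow> rat" where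
  "parking_character_B n \<sigma> = trace_on (parking_functions_B n) (permute_entries \<sigma>)"

definition power_sum :: "nat \<Rightarrow> ('n::finite, rat) mpoly" where
  "power_sum k = (\<Sum>i\<in>UNIV. Var i ^ k)"

text \<open>\<open>p\<^bsub>\<lambda>\<^esub>\<close> for \<open>\<lambda>\<close> the cycle type of a permutation of \<open>{1..n}\<close>; the cycles are the orbits,
  fixed points included.\<close>

definition power_sum_of_perm :: "nat \<Rightarrow> (nat \<Rightarrow> nat) \<Rightarrow> ('n::finite, rat) mpoly" where
  "power_sum_of_perm n \<sigma> = (\<Prod>C\<in>orbit \<sigma> ` {1..n}. power_sum (card C))"

definition frobenius_char :: "nat \<Rightarrow> ((nat \<Rightarrow> nat) \<Rightarrow> rat) \<Rightarrow> ('n::finite, rat) mpoly" where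
  "frobenius_char n \<phi> =
     Const (1 / fact n) * (\<Sum>\<sigma> | \<sigma> permutes {1..n}. Const (\<phi> \<sigma>) * power_sum_of_perm n \<sigma>)"

definition PF_B :: "nat \<Rightarrow> ('n::finite, rat) mpoly" where
  "PF_B n = frobenius_char n (parking_character_B n)"


section \<open>Umbral calculus\<close>

text \<open>Integer powers of a power series with constant term \<open>1\<close> over a commutative ring (the class
  operation \<open>inverse\<close> on series is only available when the coefficient type has one).\<close>

definition fps_ipow :: "'r::comm_ring_1 fps \<Rightarrow> int \<Rightarrow> 'r fps" where
  "fps_ipow f m = (if m \<ge> 0 then f ^ nat m else fps_right_inverse f 1 ^ nat (- m))"

lemma fps_ipow_minus:
  assumes "f $ 0 = 1"
  shows "fps_ipow f m * fps_ipow f (- m) = 1"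
proof -
  have "f * fps_right_inverse f 1 = 1"
    using assms by (intro fps_right_inverse) simp
  then show ?thesis
    by (cases "m > 0"; cases "m = 0")
       (simp_all add: fps_ipow_def power_mult_distrib[symmetric] mult.commute)
qed

text \<open>
  The enlarged alphabet: a base alphabet \<open>'a\<close> together with, for every umbra \<open>\<alpha>\<close> and every integer
  \<open>m\<close>, an auxiliary umbra \<open>Dot m \<alpha>\<close>, written \<open>m\<^bold>.\<alpha>\<close> on paper. As a new symbol, \<open>Dot m \<alpha>\<close> is
  distinct from, hence uncorrelated with, all umbrae occurring in \<open>\<alpha>\<close>; the umbrae
  \<open>Dot 1 \<alpha>\<close>, \<open>Dot 1 (Dot 1 \<alpha>)\<close>, \dots are pairwise uncorrelated copies of \<open>\<alpha>\<close>.
\<close>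

datatype 'a umbra = Umbra 'a | Dot int "'a umbra"

definition umbral_gf ::
  "(('a, ('n, rat) mpoly) mpoly \<Rightarrow> ('n, rat) mpoly) \<Rightarrow> 'a \<Rightarrow> ('n, rat) mpoly fps" where
  "umbral_gf E \<alpha> = Abs_fps (\<lambda>i. Const (1 / fact i) * E (Var \<alpha> ^ i))"

definition umbral_functional ::
  "(('a, ('n, rat) mpoly) mpoly \<Rightarrow> ('n, rat) mpoly) \<Rightarrow> bool" where
  "umbral_functional E \<longleftrightarrow>
     (\<forall>p q. E (p + q) = E p + E q) \<and>
     (\<forall>r p. E (Const r * p) = r * E p) \<and>
     E 1 = 1 \<and>
     (\<forall>S k. finite S \<longrightarrow> E (\<Prod>\<alpha>\<in>S. Var \<alpha> ^ k \<alpha>) = (\<Prod>\<alpha>\<in>S. E (Var \<alpha> ^ k \<alpha>)))"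

definition umbral_calculus ::
  "(('a umbra, ('n, rat) mpoly) mpoly \<Rightarrow> ('n, rat) mpoly) \<Rightarrow> bool" where
  "umbral_calculus E \<longleftrightarrow>
     umbral_functional E \<and>
     (\<forall>m \<alpha>. umbral_gf E (Dot m \<alpha>) = fps_ipow (umbral_gf E \<alpha>) m)"

text \<open>The axioms are consistent: every choice of moments of the base alphabet extends.\<close>

primrec extended_gf :: "('a \<Rightarrow> 'r::comm_ring_1 fps) \<Rightarrow> 'a umbra \<Rightarrow> 'r fps" where
  "extended_gf g (Umbra a) = g a"
| "extended_gf g (Dot m \<alpha>) = fps_ipow (extended_gf g \<alpha>) m"

lemma fps_ipow_nth_0:
  assumes "f $ 0 = 1"
  shows "fps_ipow f m $ 0 = 1"
proof -
  have pow: "(g ^ k) $ 0 = 1" if "g $ 0 = 1" for g :: "'a fps" and k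
    using that by (induction k) simp_all
  have "(f * fps_right_inverse f 1) $ 0 = 1"
    using assms by (subst fps_right_inverse) simp_all
  then have "fps_right_inverse f 1 $ 0 = 1"
    using assms by simp
  then show ?thesis
    using assms by (simp add: fps_ipow_def pow)
qed

lemma prod_Var_power:
  assumes "finite S"
  shows "(\<Prod>\<alpha>\<in>S. Var \<alpha> ^ k \<alpha> :: ('v, 'r::comm_ring_1) mpoly) =
    Poly_Mapping.single (\<Sum>\<alpha>\<in>S. Poly_Mapping.single \<alpha> (k \<alpha>)) 1"
proof -
  have pow: "(Var \<alpha> ^ j :: ('v, 'r) mpoly) = Poly_Mapping.single (Poly_Mapping.single \<alpha> j) 1"
    for \<alpha> j
    by (induction j) (simp_all add: Var_def mult_single single_add[symmetric])
  show ?thesis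
    using assms by induction (simp_all add: pow mult_single)
qed

lemma umbral_calculus_exists:
  fixes g :: "'a \<Rightarrow> ('n, rat) mpoly fps"
  assumes g: "\<And>a. g a $ 0 = 1"
  shows "\<exists>E. umbral_calculus E \<and> (\<forall>a. umbral_gf E (Umbra a) = g a)"
proof -
  define G where "G = extended_gf g"
  have G0: "G \<alpha> $ 0 = 1" for \<alpha>
    by (induction \<alpha>) (simp_all add: G_def g fps_ipow_nth_0)
  define M where "M \<alpha> k = Const (fact k) * G \<alpha> $ k" for \<alpha> k
  have M0: "M \<alpha> 0 = 1" for \<alpha>
    by (simp add: M_def G0 Const_def)
  define mon where "mon m = (\<Prod>\<alpha>\<in>Poly_Mapping.keys m. M \<alpha> (Poly_Mapping.lookup m \<alpha>))" for m
  define E where "E p = (\<Sum>m\<in>Poly_Mapping.keys p. Poly_Mapping.lookup p m * mon m)" for p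
  have mon_sup: "mon m = (\<Prod>\<alpha>\<in>S. M \<alpha> (Poly_Mapping.lookup m \<alpha>))"
    if "finite S" "Poly_Mapping.keys m \<subseteq> S" for m S
    unfolding mon_def using that
    by (intro prod.mono_neutral_left) (auto simp: in_keys_iff M0)
  have E_sup: "E p = (\<Sum>m\<in>S. Poly_Mapping.lookup p m * mon m)"
    if "finite S" "Poly_Mapping.keys p \<subseteq> S" for p S
    unfolding E_def using that
    by (intro sum.mono_neutral_left) (auto simp: in_keys_iff)
  have E_add: "E (p + q) = E p + E q" for p q
  proof -
    let ?S = "Poly_Mapping.keys p \<union> Poly_Mapping.keys q"
    have "E (p + q) = (\<Sum>m\<in>?S. Poly_Mapping.lookup (p + q) m * mon m)"
      by (intro E_sup keys_add) auto
    also have "\<dots> = (\<Sum>m\<in>?S. Poly_Mapping.lookup p m * mon m)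
        + (\<Sum>m\<in>?S. Poly_Mapping.lookup q m * mon m)"
      by (simp add: lookup_add algebra_simps sum.distrib)
    also have "\<dots> = E p + E q"
      by (simp add: E_sup[of ?S])
    finally show ?thesis .
  qed
  have E_single: "E (Poly_Mapping.single m c) = c * mon m" for m c
    by (simp add: E_def)
  have E_sum: "E (sum f S) = (\<Sum>s\<in>S. E (f s))" for f :: "('a umbra \<Rightarrow>\<^sub>0 nat) \<Rightarrow> _" and S
    by (induction S rule: infinite_finite_induct) (simp_all add: E_add E_def[of 0])
  have E_scale: "E (Const r * p) = r * E p" for r p
  proof -
    have p: "p = (\<Sum>m\<in>Poly_Mapping.keys p. Poly_Mapping.single m (Poly_Mapping.lookup p m))"
      by (rule poly_mapping_eqI)
         (simp add: lookup_sum lookup_single when_def in_keys_iff)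
    have "E (Const r * p) = E (\<Sum>m\<in>Poly_Mapping.keys p.
        Const r * Poly_Mapping.single m (Poly_Mapping.lookup p m))"
      unfolding sum_distrib_left[symmetric] p[symmetric] ..
    then show ?thesis
      by (simp add: E_sum E_single Const_def mult_single E_def[of p] sum_distrib_left mult.assoc)
  qed
  have lookup_sum_single:
    "Poly_Mapping.lookup (\<Sum>\<alpha>\<in>S. Poly_Mapping.single \<alpha> (k \<alpha>)) \<beta> = (if \<beta> \<in> S then k \<beta> else 0)"
    if "finite S" for S and k :: "'a umbra \<Rightarrow> nat" and \<beta>
    using that by (simp add: lookup_sum lookup_single when_def)
  have E_mon: "E (\<Prod>\<alpha>\<in>S. Var \<alpha> ^ k \<alpha>) = (\<Prod>\<alpha>\<in>S. M \<alpha> (k \<alpha>))" if S: "finite S" for S k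
  proof -
    have "mon (\<Sum>\<alpha>\<in>S. Poly_Mapping.single \<alpha> (k \<alpha>)) = (\<Prod>\<alpha>\<in>S. M \<alpha> (k \<alpha>))"
      using S by (subst mon_sup[OF S])
        (auto simp: in_keys_iff lookup_sum_single split: if_splits intro!: prod.cong)
    then show ?thesis
      by (simp add: prod_Var_power[OF S] E_single)
  qed
  have E_pow: "E (Var \<alpha> ^ k) = M \<alpha> k" for \<alpha> k
    using E_mon[of "{\<alpha>}" "\<lambda>_. k"] by simp
  have gf: "umbral_gf E \<alpha> = G \<alpha>" for \<alpha>
    by (rule fps_ext) (simp add: umbral_gf_def E_pow M_def Const_def mult_single
        mult.assoc[symmetric])
  have "umbral_functional E"
    unfolding umbral_functional_def
    using E_add E_scale E_mon E_mon[of "{}"] by (simp add: E_pow)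
  then have "umbral_calculus E"
    by (simp add: umbral_calculus_def gf G_def)
  then show ?thesis
    using gf by (auto simp: G_def)
qed

definition umbrally_equivalent :: "('p \<Rightarrow> 'r) \<Rightarrow> 'p \<Rightarrow> 'p \<Rightarrow> bool" where
  "umbrally_equivalent E p q \<longleftrightarrow> E p = E q"

text \<open>\<open>x - m\<^bold>.\<gamma>\<close> stands for \<open>x + (-m)\<^bold>.\<gamma>\<close>.\<close>

definition abel_poly ::
  "nat \<Rightarrow> ('a umbra, 'r::comm_ring_1) mpoly \<Rightarrow> 'a umbra \<Rightarrow> ('a umbra, 'r) mpoly" where
  "abel_poly n x \<gamma> = x * (x + Var (Dot (- int n) \<gamma>)) ^ (n - 1)"

definition abel_poly_B ::
  "nat \<Rightarrow> ('a umbra, 'r::comm_ring_1) mpoly \<Rightarrow> 'a umbra \<Rightarrow> ('a umbra, 'r) mpoly" where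
  "abel_poly_B n x \<gamma> = (x + Var (Dot (- int (n + 1)) \<gamma>)) ^ n"

lemma abel_poly_Suc: "abel_poly (n + 1) x \<gamma> = x * abel_poly_B n x \<gamma>"
  by (simp add: abel_poly_def abel_poly_B_def)

end

theory Submission
  imports Defs
begin

text \<open>
  The character of the parking module at \<open>\<sigma>\<close> is \<open>n\<close> to the number of cycles of \<open>\<sigma>\<close>, so \<open>n! PF\<^sub>n\<^sup>B\<close> is
  the sum over \<open>\<sigma>\<close> of the products of \<open>n p\<^bsub>|C|\<^esub>\<close> over the cycles \<open>C\<close> of \<open>\<sigma>\<close>. As \<open>n p\<^sub>k\<close> is the
  \<open>k\<close>-th power sum of the variables repeated \<open>n\<close> times, this sum counts, with weights, the pairs of a
  permutation and a colouring fixed by it. Summing over the permutations first, the stabilizer of a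
  colouring contributes the product of the factorials of its fibre sizes, which cancels against the
  multinomial coefficients and leaves \<open>n!\<close> times the coefficient of \<open>t\<^sup>n\<close> in
  \<open>\<Prod>\<^sub>i (1 - x\<^sub>i t)\<^sup>-\<^sup>n\<close>. Both umbral polynomials evaluate to the same coefficient: for
  \<open>f = f(\<theta>, t)\<close> the two uncorrelated umbrae in \<open>B\<^sub>n\<close> have generating functions \<open>f\<^sup>-\<^sup>1\<close> and
  \<open>f\<^sup>n\<^sup>+\<^sup>1\<close>, whose product is \<open>f\<^sup>n\<close>.
\<close>

section \<open>Colourings fixed by a permutation\<close>

text \<open>A colouring fixed by \<open>\<sigma>\<close> is constant on orbits, so it is a free
  choice of one colour per orbit; an orbit \<open>C\<close> coloured \<open>s\<close> carries the
  weight \<open>w s ^ card C\<close>.\<close>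

lemma sum_invariant_colourings:
  fixes w :: "'s \<Rightarrow> 'r::comm_semiring_1"
  assumes \<sigma>: "\<sigma> permutes A" and A: "finite A" and S: "finite S"
  shows "(\<Sum>c | c \<in> A \<rightarrow>\<^sub>E S \<and> (\<forall>j\<in>A. c (\<sigma> j) = c j). \<Prod>j\<in>A. w (c j)) =
    (\<Prod>C\<in>orbit \<sigma> ` A. \<Sum>s\<in>S. w s ^ card C)"
proof -
  have perm: "permutation \<sigma>"
    using \<sigma> A by (auto simp: permutation_permutes)
  \<comment> \<open>The inductive set \<open>orbit \<sigma> j\<close> starts at
    \<open>\<sigma> j\<close>; that it returns to \<open>j\<close> rests on the finiteness of
    \<open>A\<close>.\<close>
  have self: "j \<in> orbit \<sigma> j" for j
    by (rule permutation_self_in_orbit[OF perm])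
  have orbit_eq: "orbit \<sigma> k = orbit \<sigma> j" if "k \<in> orbit \<sigma> j" for j k
    using cyclic_on_orbit[OF \<sigma> A] that by (rule orbit_cyclic_eq3)
  have orbit_sub: "orbit \<sigma> j \<subseteq> A" if "j \<in> A" for j
    using \<sigma> that by (rule permutes_orbit_subset)
  have orbit_const: "c k = c j" if "\<forall>j\<in>A. c (\<sigma> j) = c j" "j \<in> A" "k \<in> orbit \<sigma> j" for c :: "'a \<Rightarrow> 's" and j k
    using that(3)
  proof induction
    case base
    then show ?case using that by simp
  next
    case (step y)
    then show ?case using that orbit_sub[OF that(2)] by auto
  qed
  let ?col = "{c. c \<in> A \<rightarrow>\<^sub>E S \<and> (\<forall>j\<in>A. c (\<sigma> j) = c j)}"
  let ?O = "orbit \<sigma> ` A"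
  have "(\<Prod>C\<in>?O. \<Sum>s\<in>S. w s ^ card C) = (\<Sum>g\<in>?O \<rightarrow>\<^sub>E S. \<Prod>C\<in>?O. w (g C) ^ card C)"
    using A S by (intro prod_sum_PiE) auto
  also have "\<dots> = (\<Sum>c\<in>?col. \<Prod>j\<in>A. w (c j))"
  \<comment> \<open>The colour of an orbit is read off at an arbitrary representative, which is
    harmless because a fixed colouring is constant there.\<close>
  proof (rule sum.reindex_bij_witness[where
        i = "\<lambda>c. \<lambda>C\<in>?O. c (SOME j. j \<in> C)" and j = "\<lambda>g. \<lambda>j\<in>A. g (orbit \<sigma> j)"])
    fix g assume g: "g \<in> ?O \<rightarrow>\<^sub>E S"
    have some: "(SOME k. k \<in> orbit \<sigma> j) \<in> orbit \<sigma> j" for j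
      using self by (rule someI)
    show "(\<lambda>C\<in>?O. (\<lambda>j\<in>A. g (orbit \<sigma> j)) (SOME j. j \<in> C)) = g"
    proof
      fix C
      show "(\<lambda>C\<in>?O. (\<lambda>j\<in>A. g (orbit \<sigma> j)) (SOME j. j \<in> C)) C = g C"
      proof (cases "C \<in> ?O")
        case True
        then obtain j where j: "j \<in> A" "C = orbit \<sigma> j" by auto
        show ?thesis
          using True orbit_sub[OF j(1)] some[of j] orbit_eq[OF some[of j]] by (auto simp: j(2))
      next
        case False
        then show ?thesis using PiE_arb[OF g False] by (simp only: restrict_apply if_False)
      qed
    qed
    show "(\<lambda>j\<in>A. g (orbit \<sigma> j)) \<in> ?col"
      using g permutes_in_image[OF \<sigma>] by (auto simp: permutation_orbit_step[OF perm])
    have "(\<Prod>j\<in>A. w (g (orbit \<sigma> j))) = (\<Prod>C\<in>?O. \<Prod>j\<in>{j\<in>A. orbit \<sigma> j = C}. w (g (orbit \<sigma> j)))"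
      using A by (intro prod.group[symmetric]) auto
    also have "\<dots> = (\<Prod>C\<in>?O. w (g C) ^ card C)"
    proof (rule prod.cong[OF refl])
      fix C assume "C \<in> ?O"
      \<comment> \<open>The points whose orbit is \<open>C\<close> are those of \<open>C\<close>
        itself; hence the exponent \<open>card C\<close>.\<close>
      then have fib: "{j\<in>A. orbit \<sigma> j = C} = C"
        using orbit_sub orbit_eq self by blast
      have "(\<Prod>j\<in>{j\<in>A. orbit \<sigma> j = C}. w (g (orbit \<sigma> j))) =
          (\<Prod>j\<in>{j\<in>A. orbit \<sigma> j = C}. w (g C))"
        by (intro prod.cong) auto
      then show "(\<Prod>j\<in>{j\<in>A. orbit \<sigma> j = C}. w (g (orbit \<sigma> j))) = w (g C) ^ card C"
        by (simp only: fib prod_constant)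
    qed
    finally show "(\<Prod>j\<in>A. w ((\<lambda>j\<in>A. g (orbit \<sigma> j)) j)) = (\<Prod>C\<in>?O. w (g C) ^ card C)"
      by simp
  next
    fix c assume c: "c \<in> ?col"
    have some: "(SOME k. k \<in> orbit \<sigma> j) \<in> orbit \<sigma> j" for j
      using self by (rule someI)
    then have c_some: "c (SOME k. k \<in> orbit \<sigma> j) = c j" if "j \<in> A" for j
      using orbit_const[of c] c that by blast
    show "(\<lambda>C\<in>?O. c (SOME j. j \<in> C)) \<in> ?O \<rightarrow>\<^sub>E S"
      using c by (auto simp: c_some)
    show "(\<lambda>j\<in>A. (\<lambda>C\<in>?O. c (SOME j. j \<in> C)) (orbit \<sigma> j)) = c"
    proof
      fix j
      show "(\<lambda>j\<in>A. (\<lambda>C\<in>?O. c (SOME j. j \<in> C)) (orbit \<sigma> j)) j = c j"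
        using c PiE_arb[of c A "\<lambda>_. S" j] by (cases "j \<in> A") (simp_all add: c_some)
    qed
  qed
  finally show ?thesis ..
qed

text \<open>Such a permutation maps every fibre of \<open>c\<close> to itself, so it is an
  independent choice of a permutation of each fibre: the stabilizer is a Young subgroup. Colours
  that do not occur have empty fibres and contribute a factor 1.\<close>

lemma card_permutations_preserving_colouring:
  assumes A: "finite A" and S: "finite S" and c: "c \<in> A \<rightarrow> S"
  shows "card {\<sigma>. \<sigma> permutes A \<and> (\<forall>j\<in>A. c (\<sigma> j) = c j)} =
    (\<Prod>s\<in>S. fact (card {j\<in>A. c j = s}))"
proof -
  let ?F = "\<lambda>s. {j\<in>A. c j = s}"
  have "bij_betw (\<lambda>\<sigma>. \<lambda>s\<in>S. perm_restrict \<sigma> (?F s))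
      {\<sigma>. \<sigma> permutes A \<and> (\<forall>j\<in>A. c (\<sigma> j) = c j)} (\<Pi>\<^sub>E s\<in>S. {p. p permutes ?F s})"
  \<comment> \<open>The inverse map glues: each \<open>j\<close> is moved by the permutation chosen
    for its own colour.\<close>
  proof (rule bij_betw_byWitness[where f' = "\<lambda>g j. if j \<in> A then g (c j) j else j"])
    show "\<forall>\<sigma>\<in>{\<sigma>. \<sigma> permutes A \<and> (\<forall>j\<in>A. c (\<sigma> j) = c j)}.
        (\<lambda>j. if j \<in> A then (\<lambda>s\<in>S. perm_restrict \<sigma> (?F s)) (c j) j else j) = \<sigma>"
      using c by (auto simp: fun_eq_iff perm_restrict_def permutes_not_in)
    show "\<forall>g\<in>\<Pi>\<^sub>E s\<in>S. {p. p permutes ?F s}.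
        (\<lambda>s\<in>S. perm_restrict (\<lambda>j. if j \<in> A then g (c j) j else j) (?F s)) = g"
    proof
      fix g assume g: "g \<in> (\<Pi>\<^sub>E s\<in>S. {p. p permutes ?F s})"
      show "(\<lambda>s\<in>S. perm_restrict (\<lambda>j. if j \<in> A then g (c j) j else j) (?F s)) = g"
      proof
        fix s
        show "(\<lambda>s\<in>S. perm_restrict (\<lambda>j. if j \<in> A then g (c j) j else j) (?F s)) s = g s"
        proof (cases "s \<in> S")
          case True
          then have "g s permutes ?F s" using g by auto
          then show ?thesis
            using True permutes_not_in[of "g s" "?F s"]
            by (auto simp: fun_eq_iff perm_restrict_def)
        next
          case False
          then show ?thesis using PiE_arb[OF g False] by (simp only: restrict_apply if_False)
        qed
      qed
    qed
    show "(\<lambda>\<sigma>. \<lambda>s\<in>S. perm_restrict \<sigma> (?F s)) ` {\<sigma>. \<sigma> permutes A \<and> (\<forall>j\<in>A. c (\<sigma> j) = c j)}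
        \<subseteq> (\<Pi>\<^sub>E s\<in>S. {p. p permutes ?F s})"
    proof (intro image_subsetI, unfold restrict_PiE_iff, intro ballI CollectI)
      fix \<sigma> s assume \<sigma>: "\<sigma> \<in> {\<sigma>. \<sigma> permutes A \<and> (\<forall>j\<in>A. c (\<sigma> j) = c j)}"
      then have "\<sigma> permutes A" by simp
      then show "perm_restrict \<sigma> (?F s) permutes ?F s"
        using \<sigma> A permutes_inj[of \<sigma> A] permutes_in_image[of \<sigma> A]
        by (intro inj_imp_permutes) (auto simp: perm_restrict_def inj_on_def inj_def)
    qed
    show "(\<lambda>g j. if j \<in> A then g (c j) j else j) ` (\<Pi>\<^sub>E s\<in>S. {p. p permutes ?F s})
        \<subseteq> {\<sigma>. \<sigma> permutes A \<and> (\<forall>j\<in>A. c (\<sigma> j) = c j)}"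
    proof (intro image_subsetI CollectI)
      fix g assume g: "g \<in> (\<Pi>\<^sub>E s\<in>S. {p. p permutes ?F s})"
      have fib: "g (c j) permutes ?F (c j)" if "j \<in> A" for j
        using g c that by (auto simp: PiE_def Pi_def)
      have im: "g (c j) j \<in> ?F (c j)" if "j \<in> A" for j
        using permutes_in_image[OF fib[OF that], of j] that by simp
      \<comment> \<open>On a finite set injectivity is enough. Equal images have equal colours, so
        both points are moved by the same permutation.\<close>
      have "inj_on (\<lambda>j. if j \<in> A then g (c j) j else j) A"
      proof (rule inj_onI)
        fix i j assume ij: "i \<in> A" "j \<in> A"
          and eq: "(if i \<in> A then g (c i) i else i) = (if j \<in> A then g (c j) j else j)"
        then have "c i = c j" using im[of i] im[of j] by auto
        then show "i = j" using ij eq permutes_inj[OF fib[of i]] by (auto dest: injD)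
      qed
      then show "(\<lambda>j. if j \<in> A then g (c j) j else j) permutes A \<and>
          (\<forall>j\<in>A. c (if j \<in> A then g (c j) j else j) = c j)"
        using A im by (auto intro!: inj_imp_permutes)
    qed
  qed
  then have "card {\<sigma>. \<sigma> permutes A \<and> (\<forall>j\<in>A. c (\<sigma> j) = c j)} =
      card (\<Pi>\<^sub>E s\<in>S. {p. p permutes ?F s})"
    by (rule bij_betw_same_card)
  also have "\<dots> = (\<Prod>s\<in>S. fact (card (?F s)))"
    using A S by (subst card_PiE) (auto intro!: prod.cong card_permutations)
  finally show ?thesis .
qed

text \<open>Recursion on the colours: once the fibre \<open>B\<close> of the new colour
  \<open>s\<close> is split off, a colouring of \<open>A - B\<close> by \<open>S\<close> remains,
  and a product of weights of the fibre sizes factors accordingly.\<close>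

lemma sum_colourings_insert:
  fixes h :: "'s \<Rightarrow> nat \<Rightarrow> 'r::comm_semiring_1"
  assumes A: "finite A" and S: "finite S" and s: "s \<notin> S"
  shows "(\<Sum>c\<in>A \<rightarrow>\<^sub>E insert s S. \<Prod>r\<in>insert s S. h r (card {j\<in>A. c j = r})) =
    (\<Sum>B\<in>Pow A. h s (card B) *
      (\<Sum>c\<in>(A - B) \<rightarrow>\<^sub>E S. \<Prod>r\<in>S. h r (card {j\<in>A - B. c j = r})))"
proof -
  have "(\<Sum>B\<in>Pow A. h s (card B) *
      (\<Sum>c\<in>(A - B) \<rightarrow>\<^sub>E S. \<Prod>r\<in>S. h r (card {j\<in>A - B. c j = r}))) =
    (\<Sum>(B, c)\<in>(SIGMA B:Pow A. (A - B) \<rightarrow>\<^sub>E S).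
      h s (card B) * (\<Prod>r\<in>S. h r (card {j\<in>A - B. c j = r})))"
    using A S by (simp add: sum_distrib_left sum.Sigma finite_PiE)
  also have "\<dots> = (\<Sum>c\<in>A \<rightarrow>\<^sub>E insert s S. \<Prod>r\<in>insert s S. h r (card {j\<in>A. c j = r}))"
  proof (rule sum.reindex_bij_witness[where
        i = "\<lambda>c. ({j\<in>A. c j = s}, restrict c (A - {j\<in>A. c j = s}))" and
        j = "\<lambda>(B, c). \<lambda>j\<in>A. if j \<in> B then s else c j"])
    fix p assume "p \<in> (SIGMA B:Pow A. (A - B) \<rightarrow>\<^sub>E S)"
    then obtain B c where p: "p = (B, c)" and B: "B \<subseteq> A" and c: "c \<in> (A - B) \<rightarrow>\<^sub>E S" by auto
    let ?d = "\<lambda>j\<in>A. if j \<in> B then s else c j"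
    have cS: "c j \<in> S" if "j \<in> A" "j \<notin> B" for j
      using c that by auto
    have fib: "{j\<in>A. ?d j = s} = B"
      using B cS s by (auto split: if_splits)
    have fib': "{j\<in>A. ?d j = r} = {j\<in>A - B. c j = r}" if "r \<in> S" for r
      using B that s by (auto split: if_splits)
    have "restrict ?d (A - B) = restrict c (A - B)"
      by (rule restrict_ext) simp
    then have "restrict ?d (A - B) = c"
      using PiE_restrict[OF c] by simp
    then show "(\<lambda>c. ({j\<in>A. c j = s}, restrict c (A - {j\<in>A. c j = s})))
        ((\<lambda>(B, c). \<lambda>j\<in>A. if j \<in> B then s else c j) p) = p"
      unfolding p prod.case fib by simp
    show "(\<lambda>(B, c). \<lambda>j\<in>A. if j \<in> B then s else c j) p \<in> A \<rightarrow>\<^sub>E insert s S"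
      using cS by (auto simp: p)
    show "(\<Prod>r\<in>insert s S. h r (card {j\<in>A. ((\<lambda>(B, c). \<lambda>j\<in>A. if j \<in> B then s else c j) p) j = r})) =
        (case p of (B, c) \<Rightarrow> h s (card B) * (\<Prod>r\<in>S. h r (card {j\<in>A - B. c j = r})))"
      unfolding p prod.case prod.insert[OF S s] fib
      by (intro arg_cong2[where f = "(*)"] refl prod.cong) (simp only: fib')
  next
    fix c assume c: "c \<in> A \<rightarrow>\<^sub>E insert s S"
    then show "({j\<in>A. c j = s}, restrict c (A - {j\<in>A. c j = s})) \<in>
        (SIGMA B:Pow A. (A - B) \<rightarrow>\<^sub>E S)"
      by auto
    show "(\<lambda>(B, c). \<lambda>j\<in>A. if j \<in> B then s else c j)
        ({j\<in>A. c j = s}, restrict c (A - {j\<in>A. c j = s})) = c"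
    proof
      fix j
      show "(\<lambda>(B, c). \<lambda>j\<in>A. if j \<in> B then s else c j)
          ({j\<in>A. c j = s}, restrict c (A - {j\<in>A. c j = s})) j = c j"
        using PiE_arb[OF c, of j] by (cases "j \<in> A") simp_all
    qed
  qed
  finally show ?thesis ..
qed

lemma sum_Pow_card:
  fixes f :: "nat \<Rightarrow> 'r::comm_semiring_1"
  assumes A: "finite A"
  shows "(\<Sum>B\<in>Pow A. f (card B)) = (\<Sum>k\<le>card A. of_nat (card A choose k) * f k)"
proof -
  have "(\<Sum>B\<in>Pow A. f (card B)) = (\<Sum>k\<le>card A. \<Sum>B\<in>{B\<in>Pow A. card B = k}. f (card B))"
    using A by (intro sum.group[symmetric]) (auto intro: card_mono)
  also have "\<dots> = (\<Sum>k\<le>card A. of_nat (card A choose k) * f k)"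
    using n_subsets[OF A] by (intro sum.cong) auto
  finally show ?thesis .
qed

text \<open>Multiplied-out form, as a commutative semiring has no division by factorials.\<close>

lemma of_nat_fact_split:
  assumes "k \<le> n"
  shows "(of_nat (fact n) :: 'r::comm_semiring_1) =
    of_nat (n choose k) * of_nat (fact k) * of_nat (fact (n - k))"
  unfolding of_nat_mult[symmetric] binomial_fact_lemma[OF assms, symmetric] by (simp only: mult_ac)

text \<open>With n = \<open>card A\<close>, the colourings with prescribed fibre sizes are counted
  by a multinomial coefficient, which the factorials turn into n!; the product of geometric series
  lists each monomial of degree n once. The induction carries this out one colour at a time.\<close>

lemma sum_colourings_fact:
  fixes w :: "'s \<Rightarrow> 'r::comm_semiring_1"
  assumes S: "finite S" and A: "finite A"
  shows "(\<Sum>c\<in>A \<rightarrow>\<^sub>E S. \<Prod>s\<in>S. of_nat (fact (card {j\<in>A. c j = s})) * w s ^ card {j\<in>A. c j = s}) =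
    of_nat (fact (card A)) * (\<Prod>s\<in>S. Abs_fps (\<lambda>k. w s ^ k)) $ card A"
  using S A
proof (induction S arbitrary: A rule: finite_induct)
  case empty
  \<comment> \<open>Without colours, both sides are 1 if \<open>A\<close> is empty and 0
    otherwise.\<close>
  then show ?case
    by (cases "A = {}") (auto simp: PiE_eq_empty_iff)
next
  case (insert s S)
  let ?h = "\<lambda>s k. of_nat (fact k) * w s ^ k :: 'r"
  let ?H = "\<Prod>s\<in>S. Abs_fps (\<lambda>k. w s ^ k)"
  let ?n = "card A"
  have "(\<Sum>c\<in>A \<rightarrow>\<^sub>E insert s S. \<Prod>r\<in>insert s S. ?h r (card {j\<in>A. c j = r})) =
    (\<Sum>B\<in>Pow A. ?h s (card B) * (of_nat (fact (card (A - B))) * ?H $ card (A - B)))"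
    unfolding sum_colourings_insert[OF insert.prems insert.hyps, of ?h]
    by (simp only: insert.IH finite_Diff insert.prems)
  also have "\<dots> = (\<Sum>B\<in>Pow A. ?h s (card B) * (of_nat (fact (?n - card B)) * ?H $ (?n - card B)))"
    using insert.prems by (intro sum.cong) (auto simp: card_Diff_subset finite_subset)
  also have "\<dots> = (\<Sum>k\<le>?n. of_nat (?n choose k) * (?h s k * (of_nat (fact (?n - k)) * ?H $ (?n - k))))"
    by (rule sum_Pow_card[OF insert.prems])
  \<comment> \<open>The binomial coefficient and the two factorials combine to
    \<open>fact ?n\<close>, leaving a Cauchy product with the geometric series of
    \<open>s\<close>.\<close>
  also have "\<dots> = (\<Sum>k\<le>?n. of_nat (fact ?n) * (w s ^ k * ?H $ (?n - k)))"
  proof (rule sum.cong[OF refl])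
    fix k assume "k \<in> {..?n}"
    then have "k \<le> ?n" by simp
    then show "of_nat (?n choose k) * (?h s k * (of_nat (fact (?n - k)) * ?H $ (?n - k))) =
        of_nat (fact ?n) * (w s ^ k * ?H $ (?n - k))"
      by (simp only: of_nat_fact_split mult_ac)
  qed
  also have "\<dots> = of_nat (fact ?n) * (\<Prod>s\<in>insert s S. Abs_fps (\<lambda>k. w s ^ k)) $ ?n"
    using insert.hyps by (simp add: fps_mult_nth sum_distrib_left atLeast0AtMost)
  finally show ?case .
qed

text \<open>The classical expansion of n! h_n in power sums over permutations, at the weights
  \<open>w s\<close> and n = \<open>card A\<close>, by counting pairs of a permutation and a fixed
  colouring in two ways.\<close>

lemma sum_permutations_prod_power_sums:
  fixes w :: "'s \<Rightarrow> 'r::comm_semiring_1"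
  assumes A: "finite A" and S: "finite S"
  shows "(\<Sum>\<sigma> | \<sigma> permutes A. \<Prod>C\<in>orbit \<sigma> ` A. \<Sum>s\<in>S. w s ^ card C) =
    of_nat (fact (card A)) * (\<Prod>s\<in>S. Abs_fps (\<lambda>k. w s ^ k)) $ card A"
proof -
  have "(\<Sum>\<sigma> | \<sigma> permutes A. \<Prod>C\<in>orbit \<sigma> ` A. \<Sum>s\<in>S. w s ^ card C) =
    (\<Sum>\<sigma> | \<sigma> permutes A. \<Sum>c | c \<in> A \<rightarrow>\<^sub>E S \<and> (\<forall>j\<in>A. c (\<sigma> j) = c j). \<Prod>j\<in>A. w (c j))"
    using A S by (intro sum.cong) (simp_all add: sum_invariant_colourings)
  also have "\<dots> = (\<Sum>c\<in>A \<rightarrow>\<^sub>E S. \<Sum>\<sigma> | \<sigma> permutes A \<and> (\<forall>j\<in>A. c (\<sigma> j) = c j). \<Prod>j\<in>A. w (c j))"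
    using sum.swap_restrict[OF finite_permutations[OF A] finite_PiE[OF A S],
        of "\<lambda>\<sigma> c. \<Prod>j\<in>A. w (c j)" "\<lambda>\<sigma> c. \<forall>j\<in>A. c (\<sigma> j) = c j"]
    by simp
  \<comment> \<open>The weight does not depend on \<open>\<sigma>\<close>, so the inner sum is the
    size of the stabilizer of \<open>c\<close> times the monomial of \<open>c\<close>.\<close>
  also have "\<dots> = (\<Sum>c\<in>A \<rightarrow>\<^sub>E S. \<Prod>s\<in>S.
      of_nat (fact (card {j\<in>A. c j = s})) * w s ^ card {j\<in>A. c j = s})"
  proof (rule sum.cong[OF refl])
    fix c assume c: "c \<in> A \<rightarrow>\<^sub>E S"
    have "(\<Prod>j\<in>A. w (c j)) = (\<Prod>s\<in>S. \<Prod>j\<in>{j\<in>A. c j = s}. w (c j))"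
      using A S c by (intro prod.group[symmetric]) auto
    also have "\<dots> = (\<Prod>s\<in>S. w s ^ card {j\<in>A. c j = s})"
      by (intro prod.cong) simp_all
    finally have *: "(\<Prod>j\<in>A. w (c j)) = (\<Prod>s\<in>S. w s ^ card {j\<in>A. c j = s})" .
    have "c \<in> A \<rightarrow> S" using c by auto
    from card_permutations_preserving_colouring[OF A S this] *
    show "(\<Sum>\<sigma> | \<sigma> permutes A \<and> (\<forall>j\<in>A. c (\<sigma> j) = c j). \<Prod>j\<in>A. w (c j)) =
      (\<Prod>s\<in>S. of_nat (fact (card {j\<in>A. c j = s})) * w s ^ card {j\<in>A. c j = s})"
      by (simp add: prod.distrib)
  qed
  also have "\<dots> = of_nat (fact (card A)) * (\<Prod>s\<in>S. Abs_fps (\<lambda>k. w s ^ k)) $ card A"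
    by (rule sum_colourings_fact[OF S A])
  finally show ?thesis .
qed


section \<open>The Frobenius characteristic\<close>

lemma Const_mult: "Const a * Const b = Const (a * b)"
  by (simp add: Const_def mult_single)

lemma Const_1 [simp]: "Const 1 = 1"
  by (simp add: Const_def)

lemma Const_of_nat [simp]: "Const (of_nat k) = of_nat k"
  by (simp add: Const_def)

lemma fact_mult_Const_inverse_fact: "of_nat (fact k) * Const (1 / fact k :: rat) = 1"
  by (simp flip: Const_of_nat add: Const_mult)

text \<open>\<open>\<sigma>\<close> acts by a permutation matrix, so the trace counts fixed
  sequences, with \<open>n\<close> choices for each orbit. The value is kept as a product over
  orbits, to be merged factor by factor with \<open>power_sum_of_perm\<close>.\<close>

lemma parking_character_B_eq:
  assumes \<sigma>: "\<sigma> permutes {1..n}"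
  shows "parking_character_B n \<sigma> = (\<Prod>C\<in>orbit \<sigma> ` {1..n}. of_nat n)"
proof -
  have fixed: "a \<circ> inv \<sigma> = a \<longleftrightarrow> (\<forall>j\<in>{1..n}. a (\<sigma> j) = a j)" for a :: "nat \<Rightarrow> nat"
  proof
    assume "a \<circ> inv \<sigma> = a"
    then have "a (\<sigma> j) = a (inv \<sigma> (\<sigma> j))" for j
      by (metis comp_apply)
    then show "\<forall>j\<in>{1..n}. a (\<sigma> j) = a j"
      by (simp add: permutes_inverses(2)[OF \<sigma>])
  next
    assume *: "\<forall>j\<in>{1..n}. a (\<sigma> j) = a j"
    \<comment> \<open>Off \<open>{1..n}\<close> the permutation is the identity, so invariance on
      \<open>{1..n}\<close> gives invariance everywhere.\<close>
    have "a (\<sigma> j) = a j" for j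
      using * permutes_not_in[OF \<sigma>] by (cases "j \<in> {1..n}") auto
    then show "a \<circ> inv \<sigma> = a"
      by (metis comp_apply ext permutes_inverses(1)[OF \<sigma>])
  qed
  have "parking_character_B n \<sigma> =
      (\<Sum>a\<in>{1..n} \<rightarrow>\<^sub>E {1..n}. if a \<circ> inv \<sigma> = a then 1 else 0)"
    unfolding parking_character_B_def trace_on_def parking_functions_B_def permute_entries_def
    by (intro sum.cong) (auto simp: lookup_single when_def)
  \<comment> \<open>The count becomes a colouring sum with all weights 1.\<close>
  also have "\<dots> = (\<Sum>a | a \<in> {1..n} \<rightarrow>\<^sub>E {1..n} \<and> (\<forall>j\<in>{1..n}. a (\<sigma> j) = a j). \<Prod>j\<in>{1..n}. 1)"
    by (simp only: fixed sum.inter_filter finite_PiE finite_atLeastAtMost prod.neutral_const)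
  also have "\<dots> = (\<Prod>C\<in>orbit \<sigma> ` {1..n}. \<Sum>s\<in>{1..n}. 1 ^ card C)"
    using \<sigma> by (rule sum_invariant_colourings) auto
  finally show ?thesis by simp
qed

lemma fact_mult_PF_B:
  "of_nat (fact n) * PF_B n =
    of_nat (fact n) * ((\<Prod>i\<in>UNIV. Abs_fps (\<lambda>k. (Var i :: ('n::finite, rat) mpoly) ^ k)) ^ n) $ n"
proof -
  \<comment> \<open>The alphabet in which every variable occurs \<open>n\<close> times; the second
    component only labels the copies.\<close>
  let ?S = "(UNIV :: 'n set) \<times> {1..n}"
  let ?x = "Var :: 'n \<Rightarrow> ('n, rat) mpoly"
  have prod_nat: "Const (\<Prod>C\<in>\<C>. of_nat n) = (\<Prod>C\<in>\<C>. of_nat n :: ('n, rat) mpoly)" for \<C> :: "nat set set"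
    using Const_of_nat[of "n ^ card \<C>"] by simp
  have "of_nat (fact n) * PF_B n =
    (\<Sum>\<sigma> | \<sigma> permutes {1..n}. Const (parking_character_B n \<sigma>) * (power_sum_of_perm n \<sigma> :: ('n, rat) mpoly))"
    unfolding PF_B_def frobenius_char_def mult.assoc[symmetric] fact_mult_Const_inverse_fact by simp
  also have "\<dots> = (\<Sum>\<sigma> | \<sigma> permutes {1..n}.
      \<Prod>C\<in>orbit \<sigma> ` {1..n}. \<Sum>s\<in>?S. ?x (fst s) ^ card C)"
  proof (rule sum.cong[OF refl])
    fix \<sigma> assume "\<sigma> \<in> {\<sigma>. \<sigma> permutes {1..n}}"
    \<comment> \<open>The factor \<open>n\<close> that the character has for each cycle turns the
      power sum of the cycle into that of the repeated alphabet.\<close>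
    moreover have "(\<Sum>s\<in>?S. ?x (fst s) ^ k) = of_nat n * power_sum k" for k
      by (simp add: sum.cartesian_product' power_sum_def sum_distrib_left)
    ultimately show "Const (parking_character_B n \<sigma>) * power_sum_of_perm n \<sigma> =
        (\<Prod>C\<in>orbit \<sigma> ` {1..n}. \<Sum>s\<in>?S. ?x (fst s) ^ card C)"
      by (simp only: mem_Collect_eq parking_character_B_eq prod_nat power_sum_of_perm_def prod.distrib)
  qed
  also have "\<dots> = of_nat (fact n) * (\<Prod>s\<in>?S. Abs_fps (\<lambda>k. ?x (fst s) ^ k)) $ n"
    by (subst sum_permutations_prod_power_sums) simp_all
  also have "(\<Prod>s\<in>?S. Abs_fps (\<lambda>k. ?x (fst s) ^ k)) = (\<Prod>i\<in>UNIV. Abs_fps (\<lambda>k. ?x i ^ k)) ^ n"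
    by (simp add: prod.cartesian_product' prod_power_distrib)
  finally show ?thesis .
qed


section \<open>Umbral evaluation\<close>

lemma fps_right_inverse_unique:
  fixes f g :: "'r::comm_ring_1 fps"
  assumes "f $ 0 = 1" and "f * g = 1"
  shows "fps_right_inverse f 1 = g"
proof -
  have "f * fps_right_inverse f 1 = 1"
    using assms(1) by (intro fps_right_inverse) simp
  then show ?thesis
    using assms(2) by (metis mult.assoc mult.commute mult_1_left)
qed

lemma fps_ipow_of_nat: "fps_ipow f (int k) = f ^ k"
  by (simp add: fps_ipow_def)

lemma fps_ipow_minus_of_nat: "fps_ipow f (- int k) = fps_right_inverse f 1 ^ k"
  \<comment> \<open>Exponent 0 falls into the nonnegative branch of \<open>fps_ipow\<close>, where
    both sides are 1.\<close>
  by (cases "k = 0") (simp_all add: fps_ipow_def)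

text \<open>Matches the factors of the generating function of \<open>\<theta>\<close> with the
  geometric series that come from counting colourings.\<close>

lemma fps_ipow_geometric:
  fixes c :: "'r::comm_ring_1"
  shows "fps_ipow (1 - fps_const c * fps_X) (- 1) = Abs_fps (\<lambda>k. c ^ k)"
proof -
  have "(1 - fps_const c * fps_X) * Abs_fps (\<lambda>k. c ^ k) = 1"
  proof (rule fps_ext)
    fix k
    show "((1 - fps_const c * fps_X) * Abs_fps (\<lambda>k. c ^ k)) $ k = 1 $ k"
      by (cases k) (simp_all add: algebra_simps)
  qed
  then have "fps_right_inverse (1 - fps_const c * fps_X) 1 = Abs_fps (\<lambda>k. c ^ k)"
    by (intro fps_right_inverse_unique) simp_all
  then show ?thesis
    using fps_ipow_minus_of_nat[of "1 - fps_const c * fps_X" 1] by simp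
qed

text \<open>Inverting twice: this gives \<open>f ^ (n + 1)\<close> as the generating function of the
  nested umbra \<open>Dot (- int (n + 1)) (Dot (- 1) \<theta>)\<close>.\<close>

lemma fps_ipow_minus_one_ipow_neg:
  fixes f :: "'r::comm_ring_1 fps"
  assumes f: "f $ 0 = 1"
  shows "fps_ipow (fps_ipow f (- 1)) (- int k) = f ^ k"
proof -
  have "fps_ipow f (- 1) $ 0 = 1"
    using f by (rule fps_ipow_nth_0)
  moreover have "fps_ipow f (- 1) * f = 1"
    using fps_ipow_minus[OF f, of 1] fps_ipow_of_nat[of f 1] by (simp add: mult.commute)
  ultimately show ?thesis
    by (simp add: fps_ipow_minus_of_nat fps_right_inverse_unique)
qed

lemma umbral_functional_power:
  fixes E :: "('a, ('n, rat) mpoly) mpoly \<Rightarrow> ('n, rat) mpoly"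
  shows "E (Var \<alpha> ^ i) = of_nat (fact i) * umbral_gf E \<alpha> $ i"
  by (simp only: umbral_gf_def fps_nth_Abs_fps mult.assoc[symmetric] fact_mult_Const_inverse_fact
      mult_1_left)

lemma umbral_functional_sum:
  assumes E: "umbral_functional E"
  shows "E (sum f S) = (\<Sum>s\<in>S. E (f s))"
proof -
  have add: "E (p + q) = E p + E q" for p q
    using E by (simp add: umbral_functional_def)
  from add[of 0 0] have "E 0 = 0" by simp
  then show ?thesis
    by (induction S rule: infinite_finite_induct) (simp_all add: add)
qed

text \<open>Distinct umbrae are uncorrelated, so the binomial expansion of the moment becomes a
  Cauchy product once moments are divided by factorials.\<close>

lemma umbral_functional_add_power:
  fixes E :: "('a, ('n, rat) mpoly) mpoly \<Rightarrow> ('n, rat) mpoly"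
  assumes E: "umbral_functional E" and neq: "\<alpha> \<noteq> \<beta>"
  shows "E ((Var \<alpha> + Var \<beta>) ^ m) = of_nat (fact m) * (umbral_gf E \<alpha> * umbral_gf E \<beta>) $ m"
proof -
  have scale: "E (of_nat r * p) = of_nat r * E p" for r p
  proof -
    have "E (Const (of_nat r) * p) = of_nat r * E p"
      using E unfolding umbral_functional_def by blast
    then show ?thesis by (simp only: Const_of_nat)
  qed
  have uncorrelated: "E (Var \<alpha> ^ i * Var \<beta> ^ j) = E (Var \<alpha> ^ i) * E (Var \<beta> ^ j)" for i j
  proof -
    \<comment> \<open>The uncorrelation axiom takes one exponent function on a set of umbrae; this
      one gives \<open>i\<close> and \<open>j\<close> separately because \<open>\<alpha>\<close> and
      \<open>\<beta>\<close> differ.\<close>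
    have "E (\<Prod>\<gamma>\<in>{\<alpha>, \<beta>}. Var \<gamma> ^ (if \<gamma> = \<alpha> then i else j)) =
        (\<Prod>\<gamma>\<in>{\<alpha>, \<beta>}. E (Var \<gamma> ^ (if \<gamma> = \<alpha> then i else j)))"
      using E finite.intros unfolding umbral_functional_def by simp
    then show ?thesis using neq by auto
  qed
  have "E ((Var \<alpha> + Var \<beta>) ^ m) =
      (\<Sum>k\<le>m. of_nat (m choose k) * (E (Var \<alpha> ^ k) * E (Var \<beta> ^ (m - k))))"
    by (simp add: binomial_ring umbral_functional_sum[OF E] mult.assoc scale uncorrelated)
  also have "\<dots> = (\<Sum>k\<le>m. of_nat (fact m) * (umbral_gf E \<alpha> $ k * umbral_gf E \<beta> $ (m - k)))"
  proof (rule sum.cong[OF refl])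
    fix k assume "k \<in> {..m}"
    then have "k \<le> m" by simp
    then show "of_nat (m choose k) * (E (Var \<alpha> ^ k) * E (Var \<beta> ^ (m - k))) =
        of_nat (fact m) * (umbral_gf E \<alpha> $ k * umbral_gf E \<beta> $ (m - k))"
      by (simp only: of_nat_fact_split umbral_functional_power mult_ac)
  qed
  finally show ?thesis
    by (simp add: fps_mult_nth sum_distrib_left atLeast0AtMost)
qed

theorem theorem4p2:
  fixes E :: "('a umbra, ('n::finite, rat) mpoly) mpoly \<Rightarrow> ('n, rat) mpoly"
    and \<theta> :: "'a umbra"
    and n :: nat
  assumes n: "n = CARD('n)"
    and E: "umbral_calculus E"
    and \<theta>: "umbral_gf E \<theta> = (\<Prod>i\<in>UNIV. fps_ipow (1 - fps_const (Var i) * fps_X) (- 1))"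
  shows "umbrally_equivalent E
           (Const (of_nat (fact n) * PF_B n))
           (abel_poly_B n (Var (Dot (- 1) \<theta>)) (Dot (- 1) \<theta>)) \<and>
         umbrally_equivalent E
           (abel_poly_B n (Var (Dot (- 1) \<theta>)) (Dot (- 1) \<theta>))
           (Var (Dot (int n) \<theta>) ^ n)"
proof -
  define f where "f = umbral_gf E \<theta>"
  have functional: "umbral_functional E"
    and dot: "umbral_gf E (Dot m \<alpha>) = fps_ipow (umbral_gf E \<alpha>) m" for m \<alpha>
    using E by (auto simp: umbral_calculus_def)
  have E_one: "E 1 = 1" and scale: "E (Const r * p) = r * E p" for r p
    using functional by (auto simp: umbral_functional_def)
  \<comment> \<open>The constant term is the zeroth moment \<open>E 1\<close>; it makes
    \<open>f\<close> invertible.\<close>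
  have f0: "f $ 0 = 1"
    using umbral_functional_power[of E \<theta> 0] E_one by (simp add: f_def)
  have f: "f = (\<Prod>i\<in>UNIV. Abs_fps (\<lambda>k. Var i ^ k))"
    by (simp add: f_def \<theta> fps_ipow_geometric)
  \<comment> \<open>An umbra cannot contain itself as a proper part, so the two symbols in the Abel
    polynomial are distinct and hence uncorrelated.\<close>
  have "\<theta> \<noteq> Dot (- 1) \<theta>"
    by (auto dest: arg_cong[where f = size])
  then have neq: "Dot (- 1) \<theta> \<noteq> Dot (- int (n + 1)) (Dot (- 1) \<theta>)"
    by simp
  have "fps_ipow f (- 1) * f = 1"
    using fps_ipow_minus[OF f0, of 1] fps_ipow_of_nat[of f 1] by (simp add: mult.commute)
  \<comment> \<open>The exponents -1 and n + 1 of the two umbrae add up to n, the exponent of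
    \<open>Dot (int n) \<theta>\<close>.\<close>
  then have "fps_ipow f (- 1) * f ^ (n + 1) = f ^ n"
    by (simp flip: mult.assoc)
  then have abel: "E (abel_poly_B n (Var (Dot (- 1) \<theta>)) (Dot (- 1) \<theta>)) = of_nat (fact n) * f ^ n $ n"
    unfolding abel_poly_B_def umbral_functional_add_power[OF functional neq] dot f_def[symmetric]
      fps_ipow_minus_one_ipow_neg[OF f0] by simp
  have "E (Var (Dot (int n) \<theta>) ^ n) = of_nat (fact n) * f ^ n $ n"
    by (simp only: umbral_functional_power dot f_def[symmetric] fps_ipow_of_nat)
  \<comment> \<open>The symmetric function lies in R, so by R-linearity and \<open>E 1 = 1\<close>
    its image as a constant evaluates to itself.\<close>
  moreover have "E (Const (of_nat (fact n) * PF_B n)) = of_nat (fact n) * f ^ n $ n"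
    using scale[of "of_nat (fact n) * PF_B n" 1] by (simp only: E_one mult_1_right fact_mult_PF_B f)
  ultimately show ?thesis
    by (simp add: umbrally_equivalent_def abel)
qed

end
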